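(* Let $w_n = Pw_{n-1}+\Delta t\,QF(w_{n-1})+\Delta t\,RF(w_n)$ be an $s$-stage implicit Peer method with stage order $s$, and let the standard stability assumption (see context) hold. Let $w(t_n)=[u(t_n+c_i\Delta t)]_{i=1}^s$, $\varepsilon_n=w(t_n)-w_n$, and assume that the global error satisfies the estimate $$\|\varepsilon_n\|\le K\|\varepsilon_0\|+\Delta t^{s}\,t_n K\,\|d_{s+1}\|_\infty\max_{0\le t\le t_n}\|u^{(s+1)}(t)\|+\mathcal O(\Delta t^{s+1})$$ for $0\le t_n\le T$, where $$d_{s+1}=\frac{1}{(s+1)!}\Big(c^{s+1}-P(c-e)^{s+1}-(s+1)Q(c-e)^{s}-(s+1)Rc^{s}\Big).$$ Then, for initial values of order $s$, the method is convergent of order $p=s$. Furthermore, if $d_{s+1}\in\mathrm{range}(I-P)$ and the initial values are of order $s+1$, then the order of convergence is $p=s+1$.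
   Context: Problem: $u'(t)=F(u(t))$, $u(0)=u_0\in\mathbb V=\mathbb R^m$, with $F$ sufficiently smooth and $u$ a (smooth) solution on an open interval containing $[0,T]$, $T>0$ fixed. Implicit Peer method: $P=(p_{ij}),Q=(q_{ij}),R=(r_{ij})$ are real $s\times s$ matrices, $R$ is lower triangular with constant diagonal $r_{ii}=\gamma>0$; the nodes $c_i\in\mathbb R$ are pairwise distinct with $c_s=1$. With constant step size $\Delta t>0$ and $t_n=n\Delta t$, the vectors $w_n=[w_{n,1},\dots,w_{n,s}]^T\in\mathbb V^s$ with $w_{n,i}\approx u(t_n+c_i\Delta t)$ satisfy $w_n = Pw_{n-1}+\Delta t\,QF(w_{n-1})+\Delta t\,RF(w_n)$, $n\ge 1$, with given starting vector $w_0$. An $s\times s$ matrix $A$ acts on $\mathbb V^s$ as $A\otimes I_m$, and $F(w)=[F(w_i)]_{i=1}^s$ for $w\in\mathbb V^s$. Norms: $\|\cdot\|$ is a norm on $\mathbb V$, and on $\mathbb V^s$ the maximum over the $s$ components of this norm. Notation: $e=(1,\dots,1)^T\in\mathbb R^s$, $c=(c_1,\dots,c_s)^T$, powers of vectors are componentwise (zeroth power equals $e$), and $$d_j=\frac1{j!}\big(c^j-P(c-e)^j-jQ(c-e)^{j-1}-jRc^{j-1}\big),\quad j\ge1.$$ The method is pre-consistent if $Pe=e$. It has stage order $q$ if it is pre-consistent and $d_j=0$ for $j=1,\dots,q$. Standard stability assumption (products of the transfer matrices are bounded in norm by a fixed constant $K$), in the form of the resulting stability estimate: there are constants $K,\Delta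 t_0,\delta>0$, independent of $n$ and $\Delta t$, such that for all $0<\Delta t\le\Delta t_0$, $n\Delta t\le T$, and all $\tilde w_0,\dots,\tilde w_n\in\mathbb V^s$ with $\|\tilde w_j-w(t_j)\|\le\delta$ for $0\le j\le n$, one has $\|\tilde w_n-w_n\|\le K\big(\|\tilde w_0-w_0\|+\sum_{j=1}^n\|\tilde r_j\|\big)$, where $\tilde r_j=\tilde w_j-P\tilde w_{j-1}-\Delta t\,QF(\tilde w_{j-1})-\Delta t\,RF(\tilde w_j)$. Initial values of order $p$: $\|w(t_0)-w_0\|=\mathcal O(\Delta t^p)$. Convergence of order $p$: $\max_{0\le n\Delta t\le T}\|w(t_n)-w_n\|=\mathcal O(\Delta t^p)$ as $\Delta t\to0$. Constants in $\mathcal O(\cdot)$ are uniform in $n$ with $n\Delta t\le T$ and may depend on $F,u,T$ and the method. *)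

theory Defs
  imports "HOL-Analysis.Analysis" "HOL-Library.Landau_Symbols"
begin

text \<open>
  Implicit Peer methods for \<open>u' = F u\<close>, \<open>u 0 = u0\<close>, on \<open>real ^ 'm\<close>. Stages are indexed by a
  finite linearly ordered type \<open>'s\<close>, so that \<open>s = CARD('s)\<close>, the last stage is \<open>Max UNIV\<close>, and
  stage vectors have type \<open>real ^ 'm ^ 's\<close>. On \<open>real ^ 's\<close> the library's \<open>1\<close> is the all-ones
  vector \<open>e\<close> and \<open>c ^ j\<close> is the componentwise power; the identity matrix is \<open>mat 1\<close>.
\<close>

definition is_norm :: "('v::real_vector \<Rightarrow> real) \<Rightarrow> bool" where
  "is_norm N \<longleftrightarrow>
     (\<forall>x. 0 \<le> N x) \<and> (\<forall>x. N x = 0 \<longleftrightarrow> x = 0) \<and>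
     (\<forall>a x. N (a *\<^sub>R x) = \<bar>a\<bar> * N x) \<and> (\<forall>x y. N (x + y) \<le> N x + N y)"

definition stage_norm :: "(real ^ 'm \<Rightarrow> real) \<Rightarrow> real ^ 'm ^ 's \<Rightarrow> real" where
  "stage_norm N w = Max (range (\<lambda>i. N (w $ i)))"

text \<open>The action of \<open>A \<otimes> I\<close>, with \<open>I\<close> the identity of \<open>real ^ 'm\<close>.\<close>

definition stage_mult :: "real ^ 's ^ 's \<Rightarrow> real ^ 'm ^ 's \<Rightarrow> real ^ 'm ^ 's" where
  "stage_mult A w = (\<chi> i. \<Sum>j\<in>UNIV. A $ i $ j *\<^sub>R w $ j)"

definition stage_fun :: "(real ^ 'm \<Rightarrow> real ^ 'm) \<Rightarrow> real ^ 'm ^ 's \<Rightarrow> real ^ 'm ^ 's" where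
  "stage_fun F w = (\<chi> i. F (w $ i))"

definition exact_stages :: "(real \<Rightarrow> real ^ 'm) \<Rightarrow> real ^ 's \<Rightarrow> real \<Rightarrow> nat \<Rightarrow> real ^ 'm ^ 's" where
  "exact_stages u c dt n = (\<chi> i. u (real n * dt + c $ i * dt))"

definition cont_differentiable ::
    "('a::real_normed_vector \<Rightarrow> 'b::real_normed_vector) \<Rightarrow> bool" where
  "cont_differentiable F \<longleftrightarrow>
     (\<exists>F' :: 'a \<Rightarrow> 'a \<Rightarrow>\<^sub>L 'b. (\<forall>x. (F has_derivative blinfun_apply (F' x)) (at x)) \<and>
        continuous_on UNIV F')"

definition vderiv :: "nat \<Rightarrow> (real \<Rightarrow> 'v::real_normed_vector) \<Rightarrow> real \<Rightarrow> 'v" where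
  "vderiv k u = ((\<lambda>f t. vector_derivative f (at t)) ^^ k) u"

text \<open>Class \<open>C\<^sup>k\<close>; meant for open \<open>J\<close>.\<close>

definition C_k_on :: "nat \<Rightarrow> (real \<Rightarrow> 'v::real_normed_vector) \<Rightarrow> real set \<Rightarrow> bool" where
  "C_k_on k u J \<longleftrightarrow>
     (\<forall>j<k. \<forall>t\<in>J. vderiv j u differentiable (at t)) \<and> continuous_on J (vderiv k u)"

definition ivp_solution ::
    "(real ^ 'm \<Rightarrow> real ^ 'm) \<Rightarrow> real ^ 'm \<Rightarrow> (real \<Rightarrow> real ^ 'm) \<Rightarrow> real set \<Rightarrow> bool" where
  "ivp_solution F u0 u J \<longleftrightarrow>
     u 0 = u0 \<and> (\<forall>t\<in>J. (u has_vector_derivative F (u t)) (at t))"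

definition implicit_peer_method ::
    "real ^ ('s::{finite,linorder}) ^ ('s::{finite,linorder}) \<Rightarrow>
     real ^ ('s::{finite,linorder}) \<Rightarrow> bool" where
  "implicit_peer_method R c \<longleftrightarrow>
     (\<forall>i j. i < j \<longrightarrow> R $ i $ j = 0) \<and> (\<exists>\<gamma>>0. \<forall>i. R $ i $ i = \<gamma>) \<and>
     inj (\<lambda>i. c $ i) \<and> c $ Max UNIV = 1"

definition order_residual ::
    "real ^ 's ^ 's \<Rightarrow> real ^ 's ^ 's \<Rightarrow> real ^ 's ^ 's \<Rightarrow> real ^ 's \<Rightarrow> nat \<Rightarrow> real ^ 's" where
  "order_residual P Q R c j = (1 / fact j) *\<^sub>R
     (c ^ j - P *v (c - 1) ^ j - real j *\<^sub>R (Q *v (c - 1) ^ (j - 1))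
        - real j *\<^sub>R (R *v c ^ (j - 1)))"

definition pre_consistent :: "real ^ 's ^ 's \<Rightarrow> bool" where
  "pre_consistent P \<longleftrightarrow> P *v 1 = 1"

definition stage_order ::
    "nat \<Rightarrow> real ^ 's ^ 's \<Rightarrow> real ^ 's ^ 's \<Rightarrow> real ^ 's ^ 's \<Rightarrow> real ^ 's \<Rightarrow> bool" where
  "stage_order q P Q R c \<longleftrightarrow>
     pre_consistent P \<and> (\<forall>j\<in>{1..q}. order_residual P Q R c j = 0)"

text \<open>
  Numerical solutions are families \<open>w dt n\<close>, where \<open>w dt 0\<close> is the starting vector for step size
  \<open>dt\<close>. Since the stage equations are implicit, they are only required to hold for all sufficiently
  small step sizes, on the time interval \<open>[0, T]\<close>.
\<close>

definition peer_solution ::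
    "(real ^ 'm \<Rightarrow> real ^ 'm) \<Rightarrow> real \<Rightarrow> real ^ 's ^ 's \<Rightarrow> real ^ 's ^ 's \<Rightarrow> real ^ 's ^ 's \<Rightarrow>
     (real \<Rightarrow> nat \<Rightarrow> real ^ 'm ^ 's) \<Rightarrow> bool" where
  "peer_solution F T P Q R w \<longleftrightarrow>
     (\<forall>\<^sub>F dt in at_right 0. \<forall>n\<ge>1. real n * dt \<le> T \<longrightarrow>
        w dt n = stage_mult P (w dt (n - 1))
          + dt *\<^sub>R stage_mult Q (stage_fun F (w dt (n - 1)))
          + dt *\<^sub>R stage_mult R (stage_fun F (w dt n)))"

definition peer_residual ::
    "(real ^ 'm \<Rightarrow> real ^ 'm) \<Rightarrow> real ^ 's ^ 's \<Rightarrow> real ^ 's ^ 's \<Rightarrow> real ^ 's ^ 's \<Rightarrow> real \<Rightarrow>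
     (nat \<Rightarrow> real ^ 'm ^ 's) \<Rightarrow> nat \<Rightarrow> real ^ 'm ^ 's" where
  "peer_residual F P Q R dt v j =
     v j - stage_mult P (v (j - 1))
       - dt *\<^sub>R stage_mult Q (stage_fun F (v (j - 1)))
       - dt *\<^sub>R stage_mult R (stage_fun F (v j))"

definition peer_stable ::
    "(real ^ 'm \<Rightarrow> real) \<Rightarrow> (real ^ 'm \<Rightarrow> real ^ 'm) \<Rightarrow> (real \<Rightarrow> real ^ 'm) \<Rightarrow> real \<Rightarrow>
     real ^ 's ^ 's \<Rightarrow> real ^ 's ^ 's \<Rightarrow> real ^ 's ^ 's \<Rightarrow> real ^ 's \<Rightarrow>
     (real \<Rightarrow> nat \<Rightarrow> real ^ 'm ^ 's) \<Rightarrow> real \<Rightarrow> bool" where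
  "peer_stable N F u T P Q R c w K \<longleftrightarrow>
     K > 0 \<and> (\<exists>dt0>0. \<exists>\<delta>>0. \<forall>dt n v.
        0 < dt \<and> dt \<le> dt0 \<and> real n * dt \<le> T \<and>
        (\<forall>j\<le>n. stage_norm N (v j - exact_stages u c dt j) \<le> \<delta>) \<longrightarrow>
          stage_norm N (v n - w dt n)
            \<le> K * (stage_norm N (v 0 - w dt 0)
                    + (\<Sum>j=1..n. stage_norm N (peer_residual F P Q R dt v j))))"

definition global_error ::
    "(real \<Rightarrow> real ^ 'm) \<Rightarrow> real ^ 's \<Rightarrow> (real \<Rightarrow> nat \<Rightarrow> real ^ 'm ^ 's) \<Rightarrow>
     real \<Rightarrow> nat \<Rightarrow> real ^ 'm ^ 's" where
  "global_error u c w dt n = exact_stages u c dt n - w dt n"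

text \<open>The constant \<open>C\<close> of the \<open>O(dt\<^sup>s\<^sup>+\<^sup>1)\<close> term is uniform in \<open>n\<close>.\<close>

definition error_estimate ::
    "(real ^ 'm \<Rightarrow> real) \<Rightarrow> (real \<Rightarrow> real ^ 'm) \<Rightarrow> real \<Rightarrow>
     real ^ 's ^ 's \<Rightarrow> real ^ 's ^ 's \<Rightarrow> real ^ 's ^ 's \<Rightarrow> real ^ 's \<Rightarrow>
     (real \<Rightarrow> nat \<Rightarrow> real ^ 'm ^ 's) \<Rightarrow> real \<Rightarrow> bool" where
  "error_estimate N u T P Q R c w K \<longleftrightarrow>
     (\<exists>C. \<forall>\<^sub>F dt in at_right 0. \<forall>n. real n * dt \<le> T \<longrightarrow>
        stage_norm N (global_error u c w dt n)
          \<le> K * stage_norm N (global_error u c w dt 0)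
            + dt ^ CARD('s) * (real n * dt) * K
                * infnorm (order_residual P Q R c (CARD('s) + 1))
                * (SUP t\<in>{0..real n * dt}. N (vderiv (CARD('s) + 1) u t))
            + C * dt ^ (CARD('s) + 1))"

definition initial_order ::
    "(real ^ 'm \<Rightarrow> real) \<Rightarrow> (real \<Rightarrow> real ^ 'm) \<Rightarrow> real ^ 's \<Rightarrow>
     (real \<Rightarrow> nat \<Rightarrow> real ^ 'm ^ 's) \<Rightarrow> nat \<Rightarrow> bool" where
  "initial_order N u c w p \<longleftrightarrow>
     (\<lambda>dt. stage_norm N (global_error u c w dt 0)) \<in> O[at_right 0](\<lambda>dt. dt ^ p)"

definition convergent_of_order ::
    "(real ^ 'm \<Rightarrow> real) \<Rightarrow> (real \<Rightarrow> real ^ 'm) \<Rightarrow> real \<Rightarrow> real ^ 's \<Rightarrow>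
     (real \<Rightarrow> nat \<Rightarrow> real ^ 'm ^ 's) \<Rightarrow> nat \<Rightarrow> bool" where
  "convergent_of_order N u T c w p \<longleftrightarrow>
     (\<lambda>dt. Max ((\<lambda>n. stage_norm N (global_error u c w dt n)) ` {n. real n * dt \<le> T}))
       \<in> O[at_right 0](\<lambda>dt. dt ^ p)"

end

theory Submission
  imports Defs
begin

text \<open>
  Order \<open>s\<close> is read off the error estimate: its middle term carries the factor \<open>dt\<^sup>s t\<^sub>n\<close>, and
  \<open>u\<^sup>(\<^sup>s\<^sup>+\<^sup>1\<^sup>)\<close> is bounded on \<open>[0, T]\<close>.

  For order \<open>s + 1\<close> this estimate is too weak. The exact solution has residuals
  \<open>dt\<^sup>s\<^sup>+\<^sup>1 d\<^sub>s\<^sub>+\<^sub>1 u\<^sup>(\<^sup>s\<^sup>+\<^sup>1\<^sup>)(t\<^sub>n) + O(dt\<^sup>s\<^sup>+\<^sup>2)\<close>, and when the stability estimate adds up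
  about \<open>1/dt\<close> of them, one power of \<open>dt\<close> is lost. If \<open>d\<^sub>s\<^sub>+\<^sub>1 = (I - P) x\<close>, however, the leading
  term can be absorbed: subtract \<open>dt\<^sup>s\<^sup>+\<^sup>1 x \<otimes> u\<^sup>(\<^sup>s\<^sup>+\<^sup>1\<^sup>)(t\<^sub>n)\<close> from the exact stage values
  (\<open>corrected_stages\<close>). Since \<open>u\<^sup>(\<^sup>s\<^sup>+\<^sup>1\<^sup>)\<close> changes only by \<open>O(dt)\<close> in one step, this changes the
  linear part of the residual by \<open>-dt\<^sup>s\<^sup>+\<^sup>1 (I - P) x \<otimes> u\<^sup>(\<^sup>s\<^sup>+\<^sup>1\<^sup>)(t\<^sub>n) + O(dt\<^sup>s\<^sup>+\<^sup>2)\<close>, which cancels the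
  leading term; the terms with \<open>F\<close> carry a factor \<open>dt\<close> and change by \<open>O(dt\<^sup>s\<^sup>+\<^sup>2)\<close>, because \<open>F\<close> is
  Lipschitz on bounded sets. So the corrected values have residuals \<open>O(dt\<^sup>s\<^sup>+\<^sup>2)\<close>
  (\<open>corrected_stages_residual\<close>), and stability puts them within \<open>O(dt\<^sup>s\<^sup>+\<^sup>1)\<close> of the numerical
  solution. They are also within \<open>O(dt\<^sup>s\<^sup>+\<^sup>1)\<close> of the exact solution, which gives the second claim.

  The expansion of the residual is Taylor's theorem for \<open>u\<close> and for \<open>u' = F \<circ> u\<close> around \<open>t\<^sub>n\<close>: the
  Taylor polynomials contribute \<open>\<Sum>\<^sub>k dt\<^sup>k d\<^sub>k u\<^sup>(\<^sup>k\<^sup>)(t\<^sub>n)\<close> (\<open>taylor_polynomial_defect\<close>), and the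
  order conditions remove all terms below \<open>k = s + 1\<close>.
\<close>

section \<open>Bounds that are uniform in time\<close>

text \<open>
  The time \<open>t\<close> of a step is a free variable here, independent of the grid, so that bounds
  can be combined for real \<open>t\<close> and specialised to \<open>t = n h\<close> at the end.
\<close>

definition uniform_O :: "real set \<Rightarrow> (real \<Rightarrow> real \<Rightarrow> 'v::real_normed_vector) \<Rightarrow> nat \<Rightarrow> bool" where
  "uniform_O S g k \<longleftrightarrow> (\<exists>C. \<forall>\<^sub>F h in at_right 0. \<forall>t\<in>S. norm (g h t) \<le> C * h ^ k)"

lemma uniform_O_I:
  assumes "\<forall>\<^sub>F h in at_right 0. \<forall>t\<in>S. norm (g h t) \<le> C * h ^ k"
  shows "uniform_O S g k"
  using assms unfolding uniform_O_def by blast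

lemma uniform_O_cong:
  assumes "uniform_O S f k" and "\<forall>\<^sub>F h in at_right 0. \<forall>t\<in>S. f h t = g h t"
  shows "uniform_O S g k"
proof -
  obtain C where "\<forall>\<^sub>F h in at_right 0. \<forall>t\<in>S. norm (f h t) \<le> C * h ^ k"
    using assms(1) unfolding uniform_O_def by blast
  with assms(2) have "\<forall>\<^sub>F h in at_right 0. \<forall>t\<in>S. norm (g h t) \<le> C * h ^ k"
    by eventually_elim auto
  then show ?thesis by (rule uniform_O_I)
qed

lemma uniform_O_0: "uniform_O S (\<lambda>h t. 0) k"
  by (rule uniform_O_I[where C = 0]) simp

lemma uniform_O_add:
  assumes "uniform_O S f k" and "uniform_O S g k"
  shows "uniform_O S (\<lambda>h t. f h t + g h t) k"
proof -
  obtain A where A: "\<forall>\<^sub>F h in at_right 0. \<forall>t\<in>S. norm (f h t) \<le> A * h ^ k"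
    using assms(1) unfolding uniform_O_def by blast
  obtain B where B: "\<forall>\<^sub>F h in at_right 0. \<forall>t\<in>S. norm (g h t) \<le> B * h ^ k"
    using assms(2) unfolding uniform_O_def by blast
  from A B have "\<forall>\<^sub>F h in at_right 0. \<forall>t\<in>S. norm (f h t + g h t) \<le> (A + B) * h ^ k"
    by eventually_elim (auto simp: distrib_right intro!: norm_triangle_mono)
  then show ?thesis by (rule uniform_O_I)
qed

lemma uniform_O_scaleR:
  assumes "uniform_O S f k"
  shows "uniform_O S (\<lambda>h t. a *\<^sub>R f h t) k"
proof -
  obtain A where A: "\<forall>\<^sub>F h in at_right 0. \<forall>t\<in>S. norm (f h t) \<le> A * h ^ k"
    using assms unfolding uniform_O_def by blast
  from A have "\<forall>\<^sub>F h in at_right 0. \<forall>t\<in>S. norm (a *\<^sub>R f h t) \<le> (\<bar>a\<bar> * A) * h ^ k"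
    by eventually_elim (auto simp: mult.assoc intro!: mult_left_mono)
  then show ?thesis by (rule uniform_O_I)
qed

lemma uniform_O_diff:
  assumes "uniform_O S f k" and "uniform_O S g k"
  shows "uniform_O S (\<lambda>h t. f h t - g h t) k"
  using uniform_O_add[OF assms(1) uniform_O_scaleR[OF assms(2), of "-1"]] by simp

lemma uniform_O_sum:
  assumes "\<And>i. i \<in> A \<Longrightarrow> uniform_O S (f i) k"
  shows "uniform_O S (\<lambda>h t. \<Sum>i\<in>A. f i h t) k"
  using assms by (induction A rule: infinite_finite_induct) (auto intro: uniform_O_0 uniform_O_add)

lemma uniform_O_power_mult:
  assumes "uniform_O S f k"
  shows "uniform_O S (\<lambda>h t. h ^ j *\<^sub>R f h t) (j + k)"
proof -
  obtain A where A: "\<forall>\<^sub>F h in at_right 0. \<forall>t\<in>S. norm (f h t) \<le> A * h ^ k"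
    using assms unfolding uniform_O_def by blast
  have "\<forall>\<^sub>F h in at_right (0::real). 0 < h"
    by (rule eventually_at_right_less)
  with A have "\<forall>\<^sub>F h in at_right 0. \<forall>t\<in>S. norm (h ^ j *\<^sub>R f h t) \<le> A * h ^ (j + k)"
  proof eventually_elim
    case (elim h)
    then have "h ^ j * norm (f h t) \<le> h ^ j * (A * h ^ k)" if "t \<in> S" for t
      using that by (intro mult_left_mono) auto
    with elim show ?case by (auto simp: power_add algebra_simps)
  qed
  then show ?thesis by (rule uniform_O_I)
qed

lemmas uniform_O_step_mult = uniform_O_power_mult[where j = 1, simplified]

section \<open>Taylor expansion along a trajectory\<close>

text \<open>
  Induction on \<open>k\<close> by the mean value inequality: the remainder vanishes at \<open>y = 0\<close>, and its
  derivative in \<open>y\<close> is the remainder of order \<open>k\<close> for the shifted sequence \<open>E 1, E 2, \<dots>\<close>. Steps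
  of either sign are covered, as needed for nodes \<open>c\<^sub>i - 1 < 0\<close>. The factor \<open>1/k!\<close> is given away.
\<close>

lemma taylor_remainder_bound:
  fixes E :: "nat \<Rightarrow> real \<Rightarrow> 'v::real_normed_vector"
  assumes "convex S"
    and "\<And>j x. j < k \<Longrightarrow> x \<in> S \<Longrightarrow> (E j has_vector_derivative E (Suc j) x) (at x)"
    and "\<And>x. x \<in> S \<Longrightarrow> norm (E k x) \<le> M"
    and "t \<in> S" and "t + y \<in> S"
  shows "norm (E 0 (t + y) - (\<Sum>j<k. (y ^ j / fact j) *\<^sub>R E j t)) \<le> M * \<bar>y\<bar> ^ k"
  using assms(2,3,5)
proof (induction k arbitrary: E y)
  case 0
  then show ?case by simp
next
  case (Suc k)
  define r where "r z = E 0 (t + z) - (\<Sum>j<Suc k. (z ^ j / fact j) *\<^sub>R E j t)" for z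
  define r' where "r' z = E 1 (t + z) - (\<Sum>j<k. (z ^ j / fact j) *\<^sub>R E (Suc j) t)" for z
  have seg: "t + z \<in> S" if "z \<in> closed_segment 0 y" for z
  proof -
    have "t + z \<in> closed_segment t (t + y)"
      using that closed_segment_translation_eq[of t z 0 y] by simp
    then show ?thesis
      using closed_segment_subset[OF \<open>t \<in> S\<close> \<open>t + y \<in> S\<close> \<open>convex S\<close>] by blast
  qed
  have r'_bound: "norm (r' z) \<le> M * \<bar>y\<bar> ^ k" if z: "z \<in> closed_segment 0 y" for z
  proof -
    have "norm (r' z) \<le> M * \<bar>z\<bar> ^ k"
      using Suc.IH[of "\<lambda>j. E (Suc j)" z] Suc.prems(1,2) seg[OF z] by (simp add: r'_def)
    moreover have "\<bar>z\<bar> \<le> \<bar>y\<bar>"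
      using z by (auto simp: closed_segment_eq_real_ivl split: if_splits)
    moreover have "0 \<le> M"
      using Suc.prems(2)[OF \<open>t \<in> S\<close>] norm_ge_zero order_trans by blast
    ultimately show ?thesis
      by (meson abs_ge_zero mult_left_mono order_trans power_mono)
  qed
  have term_deriv: "((\<lambda>z. (z ^ Suc j / fact (Suc j)) *\<^sub>R x)
      has_vector_derivative (z ^ j / fact j) *\<^sub>R x) (at z within T)" for j z T and x :: 'v
  proof -
    have "((\<lambda>z::real. z ^ Suc j) has_field_derivative real (Suc j) * z ^ j) (at z within T)"
      using DERIV_power[OF DERIV_ident, of "Suc j" z T] by simp
    from DERIV_cdivide[OF this, of "fact (Suc j)"]
    have "((\<lambda>z::real. z ^ Suc j / fact (Suc j)) has_field_derivative z ^ j / fact j) (at z within T)"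
      by (simp add: fact_Suc del: of_nat_Suc power_Suc)
    then show ?thesis
      using has_vector_derivative_scaleR[OF _ has_vector_derivative_const] by fastforce
  qed
  have "(r has_vector_derivative r' z) (at z within closed_segment 0 y)"
    if z: "z \<in> closed_segment 0 y" for z
  proof -
    have "(E 0 has_vector_derivative E 1 (t + z)) (at (t + z))"
      using Suc.prems(1)[of 0 "t + z"] seg[OF z] by simp
    moreover have "((\<lambda>z. t + z) has_vector_derivative 1) (at z within closed_segment 0 y)"
      by (auto intro!: derivative_eq_intros)
    ultimately have "((\<lambda>z. E 0 (t + z)) has_vector_derivative E 1 (t + z)) (at z within closed_segment 0 y)"
      using vector_diff_chain_within has_vector_derivative_at_within by (fastforce simp: o_def)
    then have "((\<lambda>z. E 0 (t + z) - E 0 t - (\<Sum>j<k. (z ^ Suc j / fact (Suc j)) *\<^sub>R E (Suc j) t))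
        has_vector_derivative E 1 (t + z) - 0 - (\<Sum>j<k. (z ^ j / fact j) *\<^sub>R E (Suc j) t))
        (at z within closed_segment 0 y)"
      by (intro has_vector_derivative_diff has_vector_derivative_sum term_deriv
            has_vector_derivative_const)
    moreover have "r = (\<lambda>z. E 0 (t + z) - E 0 t
        - (\<Sum>j<k. (z ^ Suc j / fact (Suc j)) *\<^sub>R E (Suc j) t))"
      by (rule ext) (simp add: r_def sum.lessThan_Suc_shift del: sum.lessThan_Suc)
    ultimately show ?thesis
      by (simp add: r'_def)
  qed
  then have "norm (r y - r 0) \<le> M * \<bar>y\<bar> ^ k * norm (y - 0)"
  proof (intro differentiable_bound[where S = "closed_segment 0 y" and f' = "\<lambda>z h. h *\<^sub>R r' z"])
    show "onorm (\<lambda>h. h *\<^sub>R r' z) \<le> M * \<bar>y\<bar> ^ k" if "z \<in> closed_segment 0 y" for z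
      using mult_left_mono[OF r'_bound[OF that] abs_ge_zero] by (intro onorm_le) (simp add: mult_ac)
  qed (simp_all add: has_vector_derivative_def)
  moreover have "r 0 = 0"
    by (simp add: r_def sum.lessThan_Suc_shift del: sum.lessThan_Suc)
  ultimately show ?case
    by (simp add: r_def mult_ac)
qed

lemma continuous_on_compact_norm_bound:
  fixes f :: "'a::topological_space \<Rightarrow> 'v::real_normed_vector"
  assumes "continuous_on S f" and "compact S"
  obtains M where "\<And>x. x \<in> S \<Longrightarrow> norm (f x) \<le> M"
  using compact_imp_bounded[OF compact_continuous_image[OF assms]]
  unfolding bounded_iff by blast

text \<open>
  The nodes may lie outside \<open>[0, 1]\<close>, so stage values are taken slightly outside \<open>[0, T]\<close>; the
  following two facts keep them in a compact part of the existence interval.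
\<close>

lemma open_interval_margin:
  fixes J :: "real set"
  assumes "open J" and "is_interval J" and "{0..T} \<subseteq> J" and "0 \<le> T"
  obtains \<eta> where "\<eta> > 0" and "{-\<eta>..T + \<eta>} \<subseteq> J"
proof -
  obtain a where a: "a > 0" "cball 0 a \<subseteq> J"
    using assms open_contains_cball[of J] by force
  obtain b where b: "b > 0" "cball T b \<subseteq> J"
    using assms open_contains_cball[of J] by force
  define \<eta> where "\<eta> = min a b"
  have "-\<eta> \<in> cball 0 a" "T + \<eta> \<in> cball T b"
    using a(1) b(1) by (simp_all add: \<eta>_def dist_real_def)
  then have "-\<eta> \<in> J" "T + \<eta> \<in> J"
    using a(2) b(2) by blast+
  then have "{-\<eta>..T + \<eta>} \<subseteq> J"
    using mem_is_interval_1_I[OF assms(2)] by (meson atLeastAtMost_iff subsetI)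
  then show thesis
    using that[of \<eta>] a b by (simp add: \<eta>_def)
qed

lemma eventually_shift_in_margin:
  fixes a :: real
  assumes "\<eta> > 0"
  shows "\<forall>\<^sub>F h in at_right 0. \<forall>t\<in>{0..T}. t + a * h \<in> {-\<eta>..T + \<eta>}"
proof -
  have "((\<lambda>h. a * h) \<longlongrightarrow> a * 0) (at_right 0)"
    by (intro tendsto_intros)
  then have "\<forall>\<^sub>F h in at_right 0. dist (a * h) 0 < \<eta>"
    using tendstoD[OF _ assms] by fastforce
  then show ?thesis
    by eventually_elim (auto simp: dist_real_def)
qed

lemma uniform_taylor:
  fixes E :: "nat \<Rightarrow> real \<Rightarrow> 'v::real_normed_vector"
  assumes J: "open J" "is_interval J" "{0..T} \<subseteq> J" and "0 \<le> T"
    and deriv: "\<And>j x. j < k \<Longrightarrow> x \<in> J \<Longrightarrow> (E j has_vector_derivative E (Suc j) x) (at x)"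
    and cont: "continuous_on J (E k)"
  shows "uniform_O {0..T} (\<lambda>h t. E 0 (t + a * h) - (\<Sum>j<k. ((a * h) ^ j / fact j) *\<^sub>R E j t)) k"
proof -
  obtain \<eta> where \<eta>: "\<eta> > 0" "{-\<eta>..T + \<eta>} \<subseteq> J"
    using open_interval_margin[OF J \<open>0 \<le> T\<close>] .
  obtain M where M: "\<And>x. x \<in> {-\<eta>..T + \<eta>} \<Longrightarrow> norm (E k x) \<le> M"
    using continuous_on_compact_norm_bound[OF continuous_on_subset[OF cont \<eta>(2)] compact_Icc] by blast
  have "\<forall>\<^sub>F h in at_right (0::real). 0 < h"
    by (rule eventually_at_right_less)
  with eventually_shift_in_margin[OF \<eta>(1), of T a]
  have "\<forall>\<^sub>F h in at_right 0. \<forall>t\<in>{0..T}.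
      norm (E 0 (t + a * h) - (\<Sum>j<k. ((a * h) ^ j / fact j) *\<^sub>R E j t)) \<le> (M * \<bar>a\<bar> ^ k) * h ^ k"
  proof eventually_elim
    case (elim h)
    show ?case
    proof
      fix t assume t: "t \<in> {0..T}"
      have "norm (E 0 (t + a * h) - (\<Sum>j<k. ((a * h) ^ j / fact j) *\<^sub>R E j t)) \<le> M * \<bar>a * h\<bar> ^ k"
        by (rule taylor_remainder_bound[where S = "{-\<eta>..T + \<eta>}"])
          (use elim t \<eta> deriv M in auto)
      then show "norm (E 0 (t + a * h) - (\<Sum>j<k. ((a * h) ^ j / fact j) *\<^sub>R E j t))
          \<le> (M * \<bar>a\<bar> ^ k) * h ^ k"
        using elim by (simp add: abs_mult power_mult_distrib mult.assoc)
    qed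
  qed
  then show ?thesis by (rule uniform_O_I)
qed

lemma vderiv_0: "vderiv 0 u = u"
  by (simp add: vderiv_def)

lemma C_k_on_has_vector_derivative:
  assumes "C_k_on k u J" and "j < k" and "t \<in> J"
  shows "(vderiv j u has_vector_derivative vderiv (Suc j) u t) (at t)"
  using assms by (simp add: C_k_on_def vderiv_def flip: vector_derivative_works)

lemma C_k_on_continuous_on:
  assumes "C_k_on k u J" and "j \<le> k"
  shows "continuous_on J (vderiv j u)"
proof (cases "j = k")
  case True
  then show ?thesis using assms by (simp add: C_k_on_def)
next
  case False
  then have "\<forall>t\<in>J. isCont (vderiv j u) t"
    using assms by (auto simp: C_k_on_def intro: differentiable_imp_continuous_within)
  then show ?thesis by (simp add: continuous_at_imp_continuous_on)
qed

lemma ivp_solution_vderiv_1: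
  assumes "ivp_solution F u0 u J" and "t \<in> J"
  shows "vderiv 1 u t = F (u t)"
  using assms by (auto simp: ivp_solution_def vderiv_def intro: vector_derivative_at)

section \<open>The right-hand side along perturbed trajectories\<close>

lemma cont_differentiable_lipschitz_on_bounded:
  fixes F :: "'a::euclidean_space \<Rightarrow> 'b::euclidean_space"
  assumes "cont_differentiable F"
  obtains L where "\<And>x y. norm x \<le> M \<Longrightarrow> norm y \<le> M \<Longrightarrow> norm (F x - F y) \<le> L * norm (x - y)"
proof -
  obtain F' :: "'a \<Rightarrow> 'a \<Rightarrow>\<^sub>L 'b" where
    F': "\<And>x. (F has_derivative blinfun_apply (F' x)) (at x)" and cont: "continuous_on UNIV F'"
    using assms unfolding cont_differentiable_def by blast
  obtain L where L: "\<And>x. x \<in> cball 0 M \<Longrightarrow> norm (F' x) \<le> L"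
    using continuous_on_compact_norm_bound[OF continuous_on_subset[OF cont subset_UNIV] compact_cball]
    by blast
  have "norm (F x - F y) \<le> L * norm (x - y)" if "norm x \<le> M" "norm y \<le> M" for x y
    by (rule differentiable_bound[where S = "cball 0 M" and f' = "\<lambda>x. blinfun_apply (F' x)"])
      (use that F' L in \<open>auto intro: has_derivative_at_withinI simp flip: norm_blinfun.rep_eq\<close>)
  then show thesis using that by blast
qed

text \<open>
  For small \<open>h\<close> the perturbation is below \<open>1\<close>, so exact and perturbed values lie in one fixed
  ball, where \<open>F\<close> is Lipschitz. This is where \<open>k > 0\<close> enters.
\<close>

lemma uniform_O_perturbed_rhs:
  fixes F :: "'v::euclidean_space \<Rightarrow> 'v"
  assumes F: "cont_differentiable F"
    and J: "open J" "is_interval J" "{0..T} \<subseteq> J" and "0 \<le> T"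
    and u: "continuous_on J u"
    and g: "uniform_O {0..T} g k" and "k > 0"
  shows "uniform_O {0..T} (\<lambda>h t. F (u (t + a * h) - g h t) - F (u (t + a * h))) k"
proof -
  obtain \<eta> where \<eta>: "\<eta> > 0" "{-\<eta>..T + \<eta>} \<subseteq> J"
    using open_interval_margin[OF J \<open>0 \<le> T\<close>] .
  obtain M where M: "\<And>x. x \<in> {-\<eta>..T + \<eta>} \<Longrightarrow> norm (u x) \<le> M"
    using continuous_on_compact_norm_bound[OF continuous_on_subset[OF u \<eta>(2)] compact_Icc] by blast
  obtain L where
    L: "\<And>x y. norm x \<le> M + 1 \<Longrightarrow> norm y \<le> M + 1 \<Longrightarrow> norm (F x - F y) \<le> L * norm (x - y)"
    using cont_differentiable_lipschitz_on_bounded[OF F, of "M + 1"] by blast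
  obtain C where C: "\<forall>\<^sub>F h in at_right 0. \<forall>t\<in>{0..T}. norm (g h t) \<le> C * h ^ k"
    using g unfolding uniform_O_def by blast
  have "((\<lambda>h. C * h ^ k) \<longlongrightarrow> C * 0 ^ k) (at_right 0)"
    by (intro tendsto_intros)
  then have "\<forall>\<^sub>F h in at_right 0. C * h ^ k < 1"
    using \<open>k > 0\<close> by (intro order_tendstoD(2)[of _ "C * 0 ^ k"]) (simp_all add: zero_power)
  with C eventually_shift_in_margin[OF \<eta>(1), of T a]
  have "\<forall>\<^sub>F h in at_right 0. \<forall>t\<in>{0..T}.
      norm (F (u (t + a * h) - g h t) - F (u (t + a * h))) \<le> (\<bar>L\<bar> * C) * h ^ k"
  proof eventually_elim
    case (elim h)
    show ?case
    proof
      fix t assume t: "t \<in> {0..T}"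
      have ut: "norm (u (t + a * h)) \<le> M" and gt: "norm (g h t) \<le> C * h ^ k"
        using elim t M by blast+
      then have "norm (u (t + a * h) - g h t) \<le> M + 1"
        using norm_triangle_ineq4[of "u (t + a * h)" "g h t"] elim by linarith
      then have "norm (F (u (t + a * h) - g h t) - F (u (t + a * h)))
          \<le> L * norm (u (t + a * h) - g h t - u (t + a * h))"
        using ut by (intro L) auto
      also have "\<dots> \<le> \<bar>L\<bar> * (C * h ^ k)"
        using gt by (intro mult_mono) auto
      finally show "norm (F (u (t + a * h) - g h t) - F (u (t + a * h))) \<le> (\<bar>L\<bar> * C) * h ^ k"
        by (simp add: mult.assoc)
    qed
  qed
  then show ?thesis by (rule uniform_O_I)
qed

section \<open>The residual of the corrected exact solution\<close>

lemma order_residual_0: "order_residual P Q R c 0 = 1 - P *v 1"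
  by (simp add: order_residual_def)

lemma order_residual_component:
  "order_residual P Q R c k $ i =
     (c $ i ^ k - (\<Sum>j\<in>UNIV. P $ i $ j * (c $ j - 1) ^ k)
        - real k * (\<Sum>j\<in>UNIV. Q $ i $ j * (c $ j - 1) ^ (k - 1))
        - real k * (\<Sum>j\<in>UNIV. R $ i $ j * c $ j ^ (k - 1))) / fact k"
proof -
  have power: "(x ^ n) $ j = x $ j ^ n" for x :: "real ^ 'b" and n j
    by (induction n) auto
  show ?thesis
    by (simp add: order_residual_def matrix_vector_mult_def power)
qed

text \<open>
  The order residuals are the coefficients in the residual of the Taylor polynomials: \<open>U\<close> and \<open>V\<close>
  are those of \<open>u\<close> and \<open>u'\<close> around \<open>t\<close>, evaluated at \<open>t + a h\<close>, with \<open>D k\<close> standing for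
  \<open>u\<^sup>(\<^sup>k\<^sup>)(t)\<close>. The term \<open>k = 0\<close> is \<open>1 - P 1\<close>, the defect in pre-consistency.
\<close>

lemma taylor_polynomial_defect:
  fixes D :: "nat \<Rightarrow> 'v::real_vector" and P Q R :: "real ^ 's ^ 's" and q :: nat and h :: real
  defines "U \<equiv> \<lambda>a. \<Sum>k<Suc q. ((a * h) ^ k / fact k) *\<^sub>R D k"
    and "V \<equiv> \<lambda>a. \<Sum>k<q. ((a * h) ^ k / fact k) *\<^sub>R D (Suc k)"
  shows "U (c $ i) - (\<Sum>j\<in>UNIV. P $ i $ j *\<^sub>R U (c $ j - 1))
        - h *\<^sub>R (\<Sum>j\<in>UNIV. Q $ i $ j *\<^sub>R V (c $ j - 1))
        - h *\<^sub>R (\<Sum>j\<in>UNIV. R $ i $ j *\<^sub>R V (c $ j))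
      = (\<Sum>k<Suc q. (h ^ k * order_residual P Q R c k $ i) *\<^sub>R D k)"
proof -
  have U: "U a = (\<Sum>k<Suc q. (h ^ k / fact k * a ^ k) *\<^sub>R D k)" for a
    by (simp add: U_def power_mult_distrib mult.commute)
  \<comment> \<open>Multiplying by \<open>h\<close> shifts the index; the new term \<open>k = 0\<close> vanishes by its factor \<open>k\<close>.\<close>
  have V: "h *\<^sub>R V a = (\<Sum>k<Suc q. (h ^ k / fact k * (real k * a ^ (k - 1))) *\<^sub>R D k)" for a
  proof -
    have "h *\<^sub>R V a = (\<Sum>k<q. (h ^ Suc k / fact (Suc k) * (real (Suc k) * a ^ k)) *\<^sub>R D (Suc k))"
      unfolding V_def scaleR_sum_right
      by (intro sum.cong refl) (simp add: fact_Suc power_mult_distrib mult_ac del: of_nat_Suc)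
    then show ?thesis
      by (simp add: sum.lessThan_Suc_shift del: sum.lessThan_Suc)
  qed
  have swap: "(\<Sum>j\<in>UNIV. x j *\<^sub>R (\<Sum>k<Suc q. (b k * y k j) *\<^sub>R D k))
      = (\<Sum>k<Suc q. (b k * (\<Sum>j\<in>UNIV. x j * y k j)) *\<^sub>R D k)"
    for x :: "'s \<Rightarrow> real" and b y
    unfolding scaleR_sum_right sum_distrib_left scaleR_sum_left
    by (subst sum.swap) (simp add: mult.left_commute del: sum.lessThan_Suc)
  have pull: "h *\<^sub>R (\<Sum>j\<in>UNIV. x j *\<^sub>R V (a j)) = (\<Sum>j\<in>UNIV. x j *\<^sub>R (h *\<^sub>R V (a j)))"
    for x a :: "'s \<Rightarrow> real"
    by (simp add: scaleR_sum_right mult.commute)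
  have factor: "(\<Sum>j\<in>UNIV. x j * (real k * y j)) = real k * (\<Sum>j\<in>UNIV. x j * y j)"
    for x y :: "'s \<Rightarrow> real" and k
    by (simp add: sum_distrib_left mult.left_commute)
  have common: "x / y * a - x / y * b - x / y * d - x / y * e = x * ((a - b - d - e) / y)"
    for x y a b d e :: real
    by (simp add: diff_divide_distrib right_diff_distrib)
  show ?thesis
    unfolding pull U V swap sum_subtractf[symmetric] scaleR_diff_left[symmetric]
    unfolding order_residual_component factor
    by (intro sum.cong refl arg_cong2[where f = scaleR]) (rule common)
qed

text \<open>
  The expansion is centred at the current time \<open>t\<close>, so the previous stages, at \<open>(t - h) + c\<^sub>j h\<close>,
  appear at \<open>t + (c\<^sub>j - 1) h\<close>. The expansion of \<open>u'\<close> needs one term fewer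
  than that of \<open>u\<close>, because it is multiplied by \<open>h\<close>.
\<close>

lemma exact_solution_residual:
  fixes u :: "real \<Rightarrow> real ^ 'm" and P Q R :: "real ^ 's ^ 's" and c :: "real ^ 's"
  assumes J: "open J" "is_interval J" "{0..T} \<subseteq> J" and "0 \<le> T"
    and ivp: "ivp_solution F u0 u J" and smooth: "C_k_on (q + 2) u J"
    and order: "stage_order q P Q R c"
  shows "uniform_O {0..T} (\<lambda>h t.
      u (t + c $ i * h) - (\<Sum>j\<in>UNIV. P $ i $ j *\<^sub>R u (t + (c $ j - 1) * h))
        - h *\<^sub>R (\<Sum>j\<in>UNIV. Q $ i $ j *\<^sub>R F (u (t + (c $ j - 1) * h)))
        - h *\<^sub>R (\<Sum>j\<in>UNIV. R $ i $ j *\<^sub>R F (u (t + c $ j * h)))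
      - (h ^ (q + 1) * order_residual P Q R c (q + 1) $ i) *\<^sub>R vderiv (q + 1) u t) (q + 2)"
    (is "uniform_O _ ?lhs _")
proof -
  obtain \<eta> where \<eta>: "\<eta> > 0" "{-\<eta>..T + \<eta>} \<subseteq> J"
    using open_interval_margin[OF J \<open>0 \<le> T\<close>] .
  define U where "U a h t = (\<Sum>k<Suc (q + 1). ((a * h) ^ k / fact k) *\<^sub>R vderiv k u t)" for a h t
  define V where "V a h t = (\<Sum>k<q + 1. ((a * h) ^ k / fact k) *\<^sub>R vderiv (Suc k) u t)" for a h t
  have U: "uniform_O {0..T} (\<lambda>h t. u (t + a * h) - U a h t) (q + 2)" for a
    using uniform_taylor[OF J \<open>0 \<le> T\<close>, of "q + 2" "\<lambda>k. vderiv k u" a]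
      C_k_on_has_vector_derivative[OF smooth] C_k_on_continuous_on[OF smooth]
    by (simp add: U_def vderiv_0 del: sum.lessThan_Suc)
  have V: "uniform_O {0..T} (\<lambda>h t. F (u (t + a * h)) - V a h t) (q + 1)" for a
  proof (rule uniform_O_cong)
    show "uniform_O {0..T} (\<lambda>h t. vderiv 1 u (t + a * h) - V a h t) (q + 1)"
      using uniform_taylor[OF J \<open>0 \<le> T\<close>, of "q + 1" "\<lambda>k. vderiv (Suc k) u" a]
        C_k_on_has_vector_derivative[OF smooth] C_k_on_continuous_on[OF smooth]
      by (simp add: V_def del: sum.lessThan_Suc)
    show "\<forall>\<^sub>F h in at_right 0. \<forall>t\<in>{0..T}.
        vderiv 1 u (t + a * h) - V a h t = F (u (t + a * h)) - V a h t"
      using eventually_shift_in_margin[OF \<eta>(1), of T a]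
      by eventually_elim (metis \<eta>(2) ivp_solution_vderiv_1[OF ivp] subsetD)
  qed
  have sumV: "uniform_O {0..T} (\<lambda>h t. h *\<^sub>R (\<Sum>j\<in>UNIV. A $ i $ j *\<^sub>R
      (F (u (t + a j * h)) - V (a j) h t))) (q + 2)" for A :: "real ^ 's ^ 's" and a
    using uniform_O_step_mult[OF uniform_O_sum[OF uniform_O_scaleR[OF V]]] by simp
  have zero: "order_residual P Q R c k = 0" if "k < Suc q" for k
    using order that
    by (cases k) (auto simp: stage_order_def pre_consistent_def order_residual_0)
  have defect: "U (c $ i) h t - (\<Sum>j\<in>UNIV. P $ i $ j *\<^sub>R U (c $ j - 1) h t)
        - h *\<^sub>R (\<Sum>j\<in>UNIV. Q $ i $ j *\<^sub>R V (c $ j - 1) h t)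
        - h *\<^sub>R (\<Sum>j\<in>UNIV. R $ i $ j *\<^sub>R V (c $ j) h t)
      = (h ^ (q + 1) * order_residual P Q R c (q + 1) $ i) *\<^sub>R vderiv (q + 1) u t" for h t
    using taylor_polynomial_defect[where q = "q + 1" and h = h and D = "\<lambda>k. vderiv k u t"
        and c = c and i = i and P = P and Q = Q and R = R] zero
    by (simp add: U_def V_def)
  have "uniform_O {0..T} (\<lambda>h t. (u (t + c $ i * h) - U (c $ i) h t)
      - (\<Sum>j\<in>UNIV. P $ i $ j *\<^sub>R (u (t + (c $ j - 1) * h) - U (c $ j - 1) h t))
      - h *\<^sub>R (\<Sum>j\<in>UNIV. Q $ i $ j *\<^sub>R (F (u (t + (c $ j - 1) * h)) - V (c $ j - 1) h t))
      - h *\<^sub>R (\<Sum>j\<in>UNIV. R $ i $ j *\<^sub>R (F (u (t + c $ j * h)) - V (c $ j) h t))) (q + 2)"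
    (is "uniform_O _ ?rhs _")
    by (intro uniform_O_diff uniform_O_sum uniform_O_scaleR U sumV)
  moreover have "?rhs h t = ?lhs h t" for h t
    unfolding defect[symmetric]
    by (simp add: scaleR_diff_right sum_subtractf algebra_simps)
  ultimately show ?thesis by simp
qed

text \<open>
  In every stage the correction uses the derivative at the step time \<open>t\<^sub>n\<close>, not at the stage
  time: then \<open>P\<close> acts on it through \<open>x\<close> alone, and the residual involves exactly \<open>(I - P) x\<close>.
\<close>

definition corrected_stages ::
    "nat \<Rightarrow> (real \<Rightarrow> real ^ 'm) \<Rightarrow> real ^ 's \<Rightarrow> real ^ 's \<Rightarrow> real \<Rightarrow> nat \<Rightarrow> real ^ 'm ^ 's" where
  "corrected_stages q u c x h n =
     (\<chi> i. u (real n * h + c $ i * h)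
       - h ^ (q + 1) *\<^sub>R (x $ i *\<^sub>R vderiv (q + 1) u (real n * h)))"

text \<open>
  The residual is the sum of the remainder \<open>E\<close> of the exact solution and three differences that
  are each \<open>O(h\<^sup>q\<^sup>+\<^sup>2)\<close>. The terms \<open>h\<^sup>q\<^sup>+\<^sup>1 (I - P) x \<otimes> u\<^sup>(\<^sup>q\<^sup>+\<^sup>1\<^sup>)(t\<^sub>n)\<close> of the exact residual and
  of the correction cancel once the derivative at \<open>t\<^sub>n - h\<close> is replaced by that at \<open>t\<^sub>n\<close>.
\<close>

lemma corrected_stages_residual:
  fixes u :: "real \<Rightarrow> real ^ 'm" and P Q R :: "real ^ 's ^ 's" and c x :: "real ^ 's"
  assumes J: "open J" "is_interval J" "{0..T} \<subseteq> J" and "0 \<le> T"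
    and F: "cont_differentiable F"
    and ivp: "ivp_solution F u0 u J" and smooth: "C_k_on (q + 2) u J"
    and order: "stage_order q P Q R c"
    and range: "order_residual P Q R c (q + 1) = (mat 1 - P) *v x"
  shows "\<exists>C. \<forall>\<^sub>F h in at_right 0. \<forall>n\<ge>1. real n * h \<le> T \<longrightarrow>
    (\<forall>i. norm (peer_residual F P Q R h (corrected_stages q u c x h) n $ i) \<le> C * h ^ (q + 2))"
proof -
  define D where "D = vderiv (q + 1) u"
  have D_O: "uniform_O {0..T} (\<lambda>h t. D (t + a * h)) 0" for a
    using uniform_taylor[OF J \<open>0 \<le> T\<close>, of 0 "\<lambda>k. D" a] C_k_on_continuous_on[OF smooth]
    by (simp add: D_def)
  have D_step: "uniform_O {0..T} (\<lambda>h t. D (t + (- 1) * h) - D t) 1"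
    using uniform_taylor[OF J \<open>0 \<le> T\<close>, of 1 "\<lambda>k. vderiv (q + 1 + k) u" "- 1"]
      C_k_on_has_vector_derivative[OF smooth] C_k_on_continuous_on[OF smooth]
    by (simp add: D_def)
  have u_cont: "continuous_on J u"
    using C_k_on_continuous_on[OF smooth, of 0] by (simp add: vderiv_0)
  \<comment> \<open>The correction seen from time \<open>t\<close>: \<open>b = 0\<close> for the current step, \<open>b = -1\<close> for the previous.\<close>
  define G where "G b y h t = h ^ (q + 1) *\<^sub>R (y *\<^sub>R D (t + b * h))" for b y h t
  have G: "uniform_O {0..T} (G b y) (q + 1)" for b y
    using uniform_O_power_mult[OF uniform_O_scaleR[OF D_O], of "q + 1"] by (simp add: G_def[abs_def])
  define H where "H a b y h t = F (u (t + a * h) - G b y h t) - F (u (t + a * h))" for a b y h t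
  have H: "uniform_O {0..T} (H a b y) (q + 1)" for a b y
    unfolding H_def using uniform_O_perturbed_rhs[OF F J \<open>0 \<le> T\<close> u_cont G] by simp
  have sumH: "uniform_O {0..T} (\<lambda>h t. h *\<^sub>R (\<Sum>j\<in>UNIV. A $ i $ j *\<^sub>R H (a j) b (y j) h t)) (q + 2)"
    for A :: "real ^ 's ^ 's" and a b y i
    using uniform_O_step_mult[OF uniform_O_sum[OF uniform_O_scaleR[OF H]]] by simp
  have shift: "uniform_O {0..T} (\<lambda>h t. \<Sum>j\<in>UNIV. (P $ i $ j * x $ j) *\<^sub>R
      (h ^ (q + 1) *\<^sub>R (D (t + (- 1) * h) - D t))) (q + 2)" for i
    using uniform_O_sum[OF uniform_O_scaleR[OF uniform_O_power_mult[OF D_step, of "q + 1"]]]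
    by (simp add: add.assoc)
  define E where "E i h t =
      u (t + c $ i * h) - (\<Sum>j\<in>UNIV. P $ i $ j *\<^sub>R u (t + (c $ j - 1) * h))
        - h *\<^sub>R (\<Sum>j\<in>UNIV. Q $ i $ j *\<^sub>R F (u (t + (c $ j - 1) * h)))
        - h *\<^sub>R (\<Sum>j\<in>UNIV. R $ i $ j *\<^sub>R F (u (t + c $ j * h)))
      - (h ^ (q + 1) * order_residual P Q R c (q + 1) $ i) *\<^sub>R D t" for i h t
  have E: "uniform_O {0..T} (E i) (q + 2)" for i
    unfolding E_def D_def using exact_solution_residual[OF J \<open>0 \<le> T\<close> ivp smooth order] .
  define r where "r i h t = E i h t
      + (\<Sum>j\<in>UNIV. (P $ i $ j * x $ j) *\<^sub>R (h ^ (q + 1) *\<^sub>R (D (t + (- 1) * h) - D t)))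
      - h *\<^sub>R (\<Sum>j\<in>UNIV. Q $ i $ j *\<^sub>R H (c $ j - 1) (- 1) (x $ j) h t)
      - h *\<^sub>R (\<Sum>j\<in>UNIV. R $ i $ j *\<^sub>R H (c $ j) 0 (x $ j) h t)" for i h t
  have "\<forall>i. uniform_O {0..T} (r i) (q + 2)"
    unfolding r_def by (intro allI uniform_O_diff uniform_O_add E shift sumH)
  from choice[OF this[unfolded uniform_O_def]] obtain C where
    C: "\<And>i. \<forall>\<^sub>F h in at_right 0. \<forall>t\<in>{0..T}. norm (r i h t) \<le> C i * h ^ (q + 2)"
    by blast
  have range_i: "order_residual P Q R c (q + 1) $ i = x $ i - (\<Sum>j\<in>UNIV. P $ i $ j * x $ j)" for i
    unfolding range by (simp add: matrix_vector_mult_diff_rdistrib)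
      (simp add: matrix_vector_mult_def)
  have residual: "peer_residual F P Q R h (corrected_stages q u c x h) n $ i = r i h (real n * h)"
    if "n \<ge> 1" for h n i
  proof -
    define t where "t = real n * h"
    have t': "real (n - 1) * h = t + (- 1) * h"
      using that by (simp add: t_def of_nat_diff algebra_simps)
    have t'': "t + (- 1) * h + a * h = t + (a - 1) * h" for a
      by (simp add: algebra_simps)
    have now: "corrected_stages q u c x h n = (\<chi> j. u (t + c $ j * h) - G 0 (x $ j) h t)"
      by (simp add: corrected_stages_def G_def D_def t_def)
    have before: "corrected_stages q u c x h (n - 1)
        = (\<chi> j. u (t + (c $ j - 1) * h) - G (- 1) (x $ j) h t)"
      unfolding corrected_stages_def G_def D_def t' t'' ..
    have FH: "F (u (t + a * h) - G b y h t) = F (u (t + a * h)) + H a b y h t" for a b y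
      by (simp add: H_def)
    have split_sum: "h *\<^sub>R (\<Sum>j\<in>UNIV. a j *\<^sub>R (y j + z j))
        = h *\<^sub>R (\<Sum>j\<in>UNIV. a j *\<^sub>R y j) + h *\<^sub>R (\<Sum>j\<in>UNIV. a j *\<^sub>R z j)"
      for a :: "'s \<Rightarrow> real" and y z :: "'s \<Rightarrow> real ^ 'm"
      by (simp add: scaleR_add_right sum.distrib)
    have split_P: "(\<Sum>j\<in>UNIV. P $ i $ j *\<^sub>R (y j - G (- 1) (x $ j) h t))
        = (\<Sum>j\<in>UNIV. P $ i $ j *\<^sub>R y j)
          - (\<Sum>j\<in>UNIV. (P $ i $ j * x $ j) *\<^sub>R (h ^ (q + 1) *\<^sub>R (D (t + (- 1) * h) - D t)))
          - (h ^ (q + 1) * (\<Sum>j\<in>UNIV. P $ i $ j * x $ j)) *\<^sub>R D t" for y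
    proof -
      have "P $ i $ j *\<^sub>R (y j - G (- 1) (x $ j) h t) = P $ i $ j *\<^sub>R y j
          - (P $ i $ j * x $ j) *\<^sub>R (h ^ (q + 1) *\<^sub>R (D (t + (- 1) * h) - D t))
          - (h ^ (q + 1) * (P $ i $ j * x $ j)) *\<^sub>R D t" for j
        by (simp add: G_def scaleR_diff_right mult_ac)
      then show ?thesis
        by (simp add: sum_subtractf sum_distrib_left scaleR_sum_left del: power_Suc)
    qed
    have "peer_residual F P Q R h (corrected_stages q u c x h) n $ i =
       u (t + c $ i * h) - G 0 (x $ i) h t
       - (\<Sum>j\<in>UNIV. P $ i $ j *\<^sub>R (u (t + (c $ j - 1) * h) - G (- 1) (x $ j) h t))
       - h *\<^sub>R (\<Sum>j\<in>UNIV. Q $ i $ j *\<^sub>R (F (u (t + (c $ j - 1) * h)) + H (c $ j - 1) (- 1) (x $ j) h t))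
       - h *\<^sub>R (\<Sum>j\<in>UNIV. R $ i $ j *\<^sub>R (F (u (t + c $ j * h)) + H (c $ j) 0 (x $ j) h t))"
      unfolding peer_residual_def now before FH[symmetric] stage_mult_def stage_fun_def by simp
    also have "\<dots> = r i h t"
      unfolding r_def E_def range_i split_P split_sum by (simp add: G_def scaleR_diff_left right_diff_distrib)
    finally show ?thesis by (simp add: t_def)
  qed
  have "\<forall>\<^sub>F h in at_right 0. \<forall>i. \<forall>t\<in>{0..T}. norm (r i h t) \<le> C i * h ^ (q + 2)"
    using C by (simp add: eventually_all_finite)
  moreover have "\<forall>\<^sub>F h in at_right (0::real). 0 < h"
    by (rule eventually_at_right_less)
  ultimately have "\<forall>\<^sub>F h in at_right 0. \<forall>n\<ge>1. real n * h \<le> T \<longrightarrow>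
    (\<forall>i. norm (peer_residual F P Q R h (corrected_stages q u c x h) n $ i)
      \<le> (\<Sum>i\<in>UNIV. \<bar>C i\<bar>) * h ^ (q + 2))"
  proof eventually_elim
    case (elim h)
    show ?case
    proof (intro allI impI)
      fix n :: nat and i assume n: "n \<ge> 1" "real n * h \<le> T"
      have "norm (r i h (real n * h)) \<le> C i * h ^ (q + 2)"
        using elim n by auto
      also have "\<dots> \<le> (\<Sum>i\<in>UNIV. \<bar>C i\<bar>) * h ^ (q + 2)"
        using elim member_le_sum[of i UNIV "\<lambda>i. \<bar>C i\<bar>"]
        by (intro mult_right_mono) auto
      finally show "norm (peer_residual F P Q R h (corrected_stages q u c x h) n $ i)
          \<le> (\<Sum>i\<in>UNIV. \<bar>C i\<bar>) * h ^ (q + 2)"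
        using residual[OF n(1)] by simp
    qed
  qed
  then show ?thesis by blast
qed

section \<open>Norms\<close>

text \<open>
  Residuals are estimated in the Euclidean norm; this transfers the bounds to the given one.
\<close>

lemma is_norm_bound:
  fixes N :: "real ^ 'm \<Rightarrow> real"
  assumes "is_norm N"
  obtains B where "0 \<le> B" and "\<And>x. N x \<le> B * norm x"
proof
  define B where "B = (\<Sum>i\<in>UNIV. N (axis i 1))"
  have nonneg: "0 \<le> N x" and scale: "N (a *\<^sub>R x) = \<bar>a\<bar> * N x"
    and triangle: "N (x + y) \<le> N x + N y" for a x y
    using assms by (auto simp: is_norm_def)
  have N0: "N 0 = 0"
    using assms by (simp add: is_norm_def)
  show "0 \<le> B" by (simp add: B_def nonneg sum_nonneg)
  have sum: "N (\<Sum>i\<in>A. f i) \<le> (\<Sum>i\<in>A. N (f i))" if "finite A" for f :: "'m \<Rightarrow> _" and A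
    using that by induction (auto simp: N0 intro: order_trans[OF triangle])
  fix x
  have "N x = N (\<Sum>i\<in>UNIV. x $ i *\<^sub>R axis i 1)"
    using basis_expansion[of x] by (simp add: scalar_mult_eq_scaleR)
  also have "\<dots> \<le> (\<Sum>i\<in>UNIV. \<bar>x $ i\<bar> * N (axis i 1))"
    using sum[of UNIV "\<lambda>i. x $ i *\<^sub>R axis i 1"] by (simp add: scale)
  also have "\<dots> \<le> (\<Sum>i\<in>UNIV. norm x * N (axis i 1))"
    by (intro sum_mono mult_right_mono nonneg component_le_norm_cart)
  finally show "N x \<le> B * norm x"
    by (simp add: B_def sum_distrib_left mult.commute)
qed

lemma stage_norm_le_iff: "stage_norm N v \<le> a \<longleftrightarrow> (\<forall>i. N (v $ i) \<le> a)"
  by (simp add: stage_norm_def)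

lemma stage_norm_component: "N (v $ i) \<le> stage_norm N v"
  using stage_norm_le_iff[of N v "stage_norm N v"] by simp

lemma stage_norm_nonneg:
  assumes "is_norm N"
  shows "0 \<le> stage_norm N v"
  using assms stage_norm_component[of N v undefined] order_trans
  unfolding is_norm_def by blast

lemma stage_norm_triangle:
  assumes "is_norm N"
  shows "stage_norm N (x - z) \<le> stage_norm N (x - y) + stage_norm N (y - z)"
proof -
  have "N (x $ i - z $ i) \<le> stage_norm N (x - y) + stage_norm N (y - z)" for i
  proof -
    have "N ((x $ i - y $ i) + (y $ i - z $ i)) \<le> N (x $ i - y $ i) + N (y $ i - z $ i)"
      using assms unfolding is_norm_def by blast
    then have "N (x $ i - z $ i) \<le> N (x $ i - y $ i) + N (y $ i - z $ i)"
      by simp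
    also have "\<dots> \<le> stage_norm N (x - y) + stage_norm N (y - z)"
      using stage_norm_component[of N "x - y" i] stage_norm_component[of N "y - z" i] by simp
    finally show ?thesis .
  qed
  then show ?thesis by (simp add: stage_norm_le_iff)
qed

lemma stage_norm_minus_commute:
  assumes "is_norm N"
  shows "stage_norm N (x - y) = stage_norm N (y - x)"
proof -
  have "N ((- 1) *\<^sub>R (y $ i - x $ i)) = \<bar>- 1\<bar> * N (y $ i - x $ i)" for i
    using assms unfolding is_norm_def by blast
  then have "N (x $ i - y $ i) = N (y $ i - x $ i)" for i
    by simp
  then show ?thesis by (simp add: stage_norm_def)
qed

section \<open>Convergence\<close>

text \<open>
  A bound for each step gives one for the maximum because for \<open>h > 0\<close> there are only
  finitely many steps up to \<open>T\<close>, and at least the step \<open>n = 0\<close>.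
\<close>

lemma convergent_of_orderI:
  assumes N: "is_norm N" and "T > 0"
    and bound: "\<forall>\<^sub>F h in at_right 0. \<forall>n. real n * h \<le> T \<longrightarrow>
      stage_norm N (global_error u c w h n) \<le> C * h ^ p"
  shows "convergent_of_order N u T c w p"
  unfolding convergent_of_order_def
proof (rule bigoI[where c = C])
  have "\<forall>\<^sub>F h in at_right (0::real). 0 < h"
    by (rule eventually_at_right_less)
  with bound show "\<forall>\<^sub>F h in at_right 0.
      norm (Max ((\<lambda>n. stage_norm N (global_error u c w h n)) ` {n. real n * h \<le> T}))
        \<le> C * norm (h ^ p)"
  proof eventually_elim
    case (elim h)
    have "{n. real n * h \<le> T} \<subseteq> {..nat \<lceil>T / h\<rceil>}"
    proof
      fix n assume "n \<in> {n. real n * h \<le> T}"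
      then have "real n \<le> T / h" using elim by (simp add: field_simps)
      then show "n \<in> {..nat \<lceil>T / h\<rceil>}" by simp linarith
    qed
    then have fin: "finite ((\<lambda>n. stage_norm N (global_error u c w h n)) ` {n. real n * h \<le> T})"
      (is "finite ?E") by (meson finite_atMost finite_imageI finite_subset)
    have start: "stage_norm N (global_error u c w h 0) \<in> ?E"
      using \<open>T > 0\<close> by auto
    have "Max ?E \<le> C * h ^ p"
      using fin start elim by (subst Max_le_iff) auto
    moreover have "0 \<le> Max ?E"
      using Max_ge[OF fin start] stage_norm_nonneg[OF N] order_trans by blast
    ultimately show ?case using elim by simp
  qed
qed

lemma initial_orderE:
  assumes "is_norm N" and "initial_order N u c w p"
  obtains C where "\<forall>\<^sub>F h in at_right 0. stage_norm N (global_error u c w h 0) \<le> C * h ^ p"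
proof -
  obtain C where "\<forall>\<^sub>F h in at_right 0.
      norm (stage_norm N (global_error u c w h 0)) \<le> C * norm (h ^ p)"
    using assms(2) unfolding initial_order_def by (elim landau_o.bigE)
  moreover have "\<forall>\<^sub>F h in at_right (0::real). 0 < h"
    by (rule eventually_at_right_less)
  ultimately have "\<forall>\<^sub>F h in at_right 0. stage_norm N (global_error u c w h 0) \<le> C * h ^ p"
    by eventually_elim auto
  then show thesis by (rule that)
qed

lemma convergent_of_stage_order:
  fixes c :: "real ^ 's"
  assumes N: "is_norm N" and "T > 0" and J: "{0..T} \<subseteq> J"
    and smooth: "C_k_on (CARD('s) + 2) u J"
    and "K > 0"
    and est: "error_estimate N u T P Q R c w K"
    and init: "initial_order N u c w CARD('s)"
  shows "convergent_of_order N u T c w CARD('s)"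
proof -
  let ?s = "CARD('s)" and ?d = "infnorm (order_residual P Q R c (CARD('s) + 1))"
  obtain B where B: "0 \<le> B" "\<And>x. N x \<le> B * norm x"
    using is_norm_bound[OF N] by blast
  have "continuous_on {0..T} (vderiv (?s + 1) u)"
    using C_k_on_continuous_on[OF smooth, of "?s + 1"] J by (auto intro: continuous_on_subset)
  then obtain M where M: "\<And>t. t \<in> {0..T} \<Longrightarrow> norm (vderiv (?s + 1) u t) \<le> M"
    using continuous_on_compact_norm_bound[OF _ compact_Icc] by blast
  have "0 \<le> M" using order_trans[OF norm_ge_zero M, of 0] \<open>T > 0\<close> by simp
  have sup: "(SUP t\<in>{0..\<tau>}. N (vderiv (?s + 1) u t)) \<le> B * M" if "0 \<le> \<tau>" "\<tau> \<le> T" for \<tau>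
  proof (rule cSUP_least)
    show "{0..\<tau>} \<noteq> {}" using that by simp
    show "N (vderiv (?s + 1) u t) \<le> B * M" if "t \<in> {0..\<tau>}" for t
      using B(2)[of "vderiv (?s + 1) u t"] mult_left_mono[OF M B(1), of t] that \<open>\<tau> \<le> T\<close>
      by fastforce
  qed
  obtain C where C: "\<forall>\<^sub>F h in at_right 0. \<forall>n. real n * h \<le> T \<longrightarrow>
      stage_norm N (global_error u c w h n)
        \<le> K * stage_norm N (global_error u c w h 0)
          + h ^ ?s * (real n * h) * K * ?d * (SUP t\<in>{0..real n * h}. N (vderiv (?s + 1) u t))
          + C * h ^ (?s + 1)"
    using est unfolding error_estimate_def by blast
  obtain C0 where C0: "\<forall>\<^sub>F h in at_right 0. stage_norm N (global_error u c w h 0) \<le> C0 * h ^ ?s"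
    using initial_orderE[OF N init] .
  have "\<forall>\<^sub>F h in at_right (0::real). 0 < h"
    by (rule eventually_at_right_less)
  moreover have "\<forall>\<^sub>F h in at_right (0::real). h < 1"
    by (auto simp: eventually_at_right_field intro: exI[of _ 1])
  ultimately have "\<forall>\<^sub>F h in at_right 0. \<forall>n. real n * h \<le> T \<longrightarrow>
      stage_norm N (global_error u c w h n) \<le> (K * C0 + T * K * ?d * (B * M) + \<bar>C\<bar>) * h ^ ?s"
    using C C0
  proof eventually_elim
    case (elim h)
    show ?case
    proof (intro allI impI)
      fix n assume n: "real n * h \<le> T"
      have "h ^ ?s * (real n * h) * K * ?d * (SUP t\<in>{0..real n * h}. N (vderiv (?s + 1) u t))
          \<le> h ^ ?s * (real n * h) * K * ?d * (B * M)"
        using elim n \<open>K > 0\<close> by (intro mult_left_mono sup) (auto simp: infnorm_pos_le)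
      also have "\<dots> \<le> h ^ ?s * T * K * ?d * (B * M)"
        using elim n \<open>K > 0\<close> B(1) \<open>0 \<le> M\<close>
        by (intro mult_right_mono mult_left_mono) (auto simp: infnorm_pos_le)
      finally have 1: "h ^ ?s * (real n * h) * K * ?d *
          (SUP t\<in>{0..real n * h}. N (vderiv (?s + 1) u t)) \<le> h ^ ?s * T * K * ?d * (B * M)" .
      have 2: "K * stage_norm N (global_error u c w h 0) \<le> K * (C0 * h ^ ?s)"
        using elim \<open>K > 0\<close> by (intro mult_left_mono) auto
      have "C * h ^ (?s + 1) \<le> \<bar>C\<bar> * h ^ (?s + 1)"
        using elim by (intro mult_right_mono) auto
      also have "\<dots> \<le> \<bar>C\<bar> * h ^ ?s"
        using elim by (intro mult_left_mono power_decreasing) auto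
      finally have 3: "C * h ^ (?s + 1) \<le> \<bar>C\<bar> * h ^ ?s" .
      have "stage_norm N (global_error u c w h n)
          \<le> K * (C0 * h ^ ?s) + h ^ ?s * T * K * ?d * (B * M) + \<bar>C\<bar> * h ^ ?s"
        using elim(3)[rule_format, OF n] 1 2 3 by linarith
      then show "stage_norm N (global_error u c w h n)
          \<le> (K * C0 + T * K * ?d * (B * M) + \<bar>C\<bar>) * h ^ ?s"
        by (simp add: algebra_simps)
    qed
  qed
  then show ?thesis by (rule convergent_of_orderI[OF N \<open>T > 0\<close>])
qed

text \<open>
  Stability is applied to the corrected stages. They start within \<open>O(h\<^sup>q\<^sup>+\<^sup>1)\<close> of the numerical
  solution by the order of the initial values, and at most \<open>T/h\<close> residuals of size
  \<open>O(h\<^sup>q\<^sup>+\<^sup>2)\<close> add up to \<open>O(h\<^sup>q\<^sup>+\<^sup>1)\<close>.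
\<close>

lemma superconvergent_of_range_condition:
  fixes P Q R :: "real ^ 's ^ 's" and u :: "real \<Rightarrow> real ^ 'm"
  assumes N: "is_norm N" and "T > 0"
    and J: "open J" "is_interval J" "{0..T} \<subseteq> J"
    and F: "cont_differentiable F"
    and ivp: "ivp_solution F u0 u J" and smooth: "C_k_on (q + 2) u J"
    and order: "stage_order q P Q R c"
    and stable: "peer_stable N F u T P Q R c w K"
    and range: "order_residual P Q R c (q + 1) = (mat 1 - P) *v x"
    and init: "initial_order N u c w (q + 1)"
  shows "convergent_of_order N u T c w (q + 1)"
proof -
  let ?v = "corrected_stages q u c x"
  obtain B where B: "0 \<le> B" "\<And>x. N x \<le> B * norm x"
    using is_norm_bound[OF N] by blast
  obtain dt0 \<delta> where "K > 0" and dt0: "dt0 > 0" and \<delta>: "\<delta> > 0"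
    and stab: "\<And>h n v. 0 < h \<Longrightarrow> h \<le> dt0 \<Longrightarrow> real n * h \<le> T \<Longrightarrow>
        (\<And>j. j \<le> n \<Longrightarrow> stage_norm N (v j - exact_stages u c h j) \<le> \<delta>) \<Longrightarrow>
          stage_norm N (v n - w h n)
            \<le> K * (stage_norm N (v 0 - w h 0)
                    + (\<Sum>j=1..n. stage_norm N (peer_residual F P Q R h v j)))"
    using stable unfolding peer_stable_def by metis
  obtain C where C: "\<forall>\<^sub>F h in at_right 0. \<forall>n\<ge>1. real n * h \<le> T \<longrightarrow>
      (\<forall>i. norm (peer_residual F P Q R h (?v h) n $ i) \<le> C * h ^ (q + 2))"
    using corrected_stages_residual[OF J less_imp_le[OF \<open>T > 0\<close>] F ivp smooth order range] by blast
  obtain C0 where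
    C0: "\<forall>\<^sub>F h in at_right 0. stage_norm N (global_error u c w h 0) \<le> C0 * h ^ (q + 1)"
    using initial_orderE[OF N init] .
  have "continuous_on {0..T} (vderiv (q + 1) u)"
    using C_k_on_continuous_on[OF smooth, of "q + 1"] J(3) by (auto intro: continuous_on_subset)
  then obtain M where M: "\<And>t. t \<in> {0..T} \<Longrightarrow> norm (vderiv (q + 1) u t) \<le> M"
    using continuous_on_compact_norm_bound[OF _ compact_Icc] by blast
  define A where "A = B * (norm x * M)"
  have close: "stage_norm N (?v h n - exact_stages u c h n) \<le> A * h ^ (q + 1)"
    if "0 < h" "real n * h \<le> T" for h n
    unfolding stage_norm_le_iff
  proof
    fix i
    have "N ((?v h n - exact_stages u c h n) $ i)
        \<le> B * norm (- (h ^ (q + 1) *\<^sub>R (x $ i *\<^sub>R vderiv (q + 1) u (real n * h))))"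
      using B(2)[of "- (h ^ (q + 1) *\<^sub>R (x $ i *\<^sub>R vderiv (q + 1) u (real n * h)))"]
      by (simp add: corrected_stages_def exact_stages_def)
    also have "\<dots> = B * (h ^ (q + 1) * (\<bar>x $ i\<bar> * norm (vderiv (q + 1) u (real n * h))))"
      using that by (simp add: abs_mult)
    also have "\<dots> \<le> B * (h ^ (q + 1) * (norm x * M))"
      using that B(1) M[of "real n * h"]
      by (intro mult_left_mono mult_mono component_le_norm_cart) auto
    finally show "N ((?v h n - exact_stages u c h n) $ i) \<le> A * h ^ (q + 1)"
      by (simp add: A_def mult_ac)
  qed
  have "((\<lambda>h. A * h ^ (q + 1)) \<longlongrightarrow> A * 0 ^ (q + 1)) (at_right 0)"
    by (intro tendsto_intros)
  then have "\<forall>\<^sub>F h in at_right 0. A * h ^ (q + 1) < \<delta>"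
    using \<delta> by (intro order_tendstoD(2)[of _ "A * 0 ^ (q + 1)"]) simp_all
  moreover have "\<forall>\<^sub>F h in at_right (0::real). 0 < h"
    by (rule eventually_at_right_less)
  moreover have "\<forall>\<^sub>F h in at_right (0::real). h < dt0"
    using dt0 by (auto simp: eventually_at_right_field intro: exI[of _ dt0])
  ultimately have "\<forall>\<^sub>F h in at_right 0. \<forall>n. real n * h \<le> T \<longrightarrow>
      stage_norm N (global_error u c w h n) \<le> (A + K * (A + C0 + T * (B * \<bar>C\<bar>))) * h ^ (q + 1)"
    using C C0
  proof eventually_elim
    case (elim h)
    have "0 < h" using elim by simp
    show ?case
    proof (intro allI impI)
      fix n assume n: "real n * h \<le> T"
      have before: "real j * h \<le> T" if "j \<le> n" for j
        using n that \<open>0 < h\<close> by (meson less_imp_le mult_right_mono of_nat_mono order_trans)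
      have res: "stage_norm N (peer_residual F P Q R h (?v h) j) \<le> B * (\<bar>C\<bar> * h ^ (q + 2))"
        if "j \<in> {1..n}" for j
        unfolding stage_norm_le_iff
      proof
        fix i
        have "norm (peer_residual F P Q R h (?v h) j $ i) \<le> C * h ^ (q + 2)"
          using elim(4) that before[of j] by auto
        also have "\<dots> \<le> \<bar>C\<bar> * h ^ (q + 2)"
          using \<open>0 < h\<close> by (intro mult_right_mono) auto
        finally show "N (peer_residual F P Q R h (?v h) j $ i) \<le> B * (\<bar>C\<bar> * h ^ (q + 2))"
          using B by (meson mult_left_mono order_trans)
      qed
      have "(\<Sum>j=1..n. stage_norm N (peer_residual F P Q R h (?v h) j))
          \<le> real n * (B * (\<bar>C\<bar> * h ^ (q + 2)))"
        using sum_bounded_above[of "{1..n}", OF res] by simp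
      also have "\<dots> = (real n * h) * (B * \<bar>C\<bar> * h ^ (q + 1))"
        by (simp add: mult_ac)
      also have "\<dots> \<le> T * (B * \<bar>C\<bar> * h ^ (q + 1))"
        using n B(1) \<open>0 < h\<close> by (intro mult_right_mono) auto
      finally have sum: "(\<Sum>j=1..n. stage_norm N (peer_residual F P Q R h (?v h) j))
          \<le> T * (B * \<bar>C\<bar> * h ^ (q + 1))" .
      have start: "stage_norm N (?v h 0 - w h 0) \<le> A * h ^ (q + 1) + C0 * h ^ (q + 1)"
        using stage_norm_triangle[OF N, of "?v h 0" "w h 0" "exact_stages u c h 0"]
          close[OF \<open>0 < h\<close>, of 0] \<open>T > 0\<close> elim(5) by (simp add: global_error_def)
      have "stage_norm N (?v h n - w h n)
          \<le> K * (stage_norm N (?v h 0 - w h 0)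
              + (\<Sum>j=1..n. stage_norm N (peer_residual F P Q R h (?v h) j)))"
        using elim(1,3) close[OF \<open>0 < h\<close> before] n
        by (intro stab \<open>0 < h\<close>) (auto intro: order_trans less_imp_le)
      also have "\<dots> \<le> K * ((A * h ^ (q + 1) + C0 * h ^ (q + 1)) + T * (B * \<bar>C\<bar> * h ^ (q + 1)))"
        using \<open>K > 0\<close> start sum by (intro mult_left_mono add_mono) auto
      finally have numeric: "stage_norm N (?v h n - w h n)
          \<le> K * ((A * h ^ (q + 1) + C0 * h ^ (q + 1)) + T * (B * \<bar>C\<bar> * h ^ (q + 1)))" .
      have "stage_norm N (global_error u c w h n)
          \<le> stage_norm N (exact_stages u c h n - ?v h n) + stage_norm N (?v h n - w h n)"
        unfolding global_error_def by (rule stage_norm_triangle[OF N])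
      also have "\<dots> \<le> A * h ^ (q + 1)
          + K * ((A * h ^ (q + 1) + C0 * h ^ (q + 1)) + T * (B * \<bar>C\<bar> * h ^ (q + 1)))"
        using close[OF \<open>0 < h\<close> n] numeric stage_norm_minus_commute[OF N] by (metis add_mono)
      finally show "stage_norm N (global_error u c w h n)
          \<le> (A + K * (A + C0 + T * (B * \<bar>C\<bar>))) * h ^ (q + 1)"
        by (simp add: algebra_simps)
    qed
  qed
  then show ?thesis by (rule convergent_of_orderI[OF N \<open>T > 0\<close>])
qed

theorem theorem2p1:
  fixes N :: "real ^ 'm \<Rightarrow> real"
    and F :: "real ^ 'm \<Rightarrow> real ^ 'm"
    and u0 :: "real ^ 'm"
    and u :: "real \<Rightarrow> real ^ 'm"
    and J :: "real set"
    and T K :: real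
    and P Q R :: "real ^ ('s::{finite,linorder}) ^ ('s::{finite,linorder})"
    and c :: "real ^ ('s::{finite,linorder})"
    and w :: "real \<Rightarrow> nat \<Rightarrow> real ^ 'm ^ ('s::{finite,linorder})"
  assumes "is_norm N"
    and "T > 0"
    and "open J" and "is_interval J" and "{0..T} \<subseteq> J"
    and "cont_differentiable F"
    and "ivp_solution F u0 u J"
    and "C_k_on (CARD('s) + 2) u J"
    and "implicit_peer_method R c"
    and "peer_solution F T P Q R w"
    and "stage_order CARD('s) P Q R c"
    and "peer_stable N F u T P Q R c w K"
    and "error_estimate N u T P Q R c w K"
  shows "(initial_order N u c w CARD('s) \<longrightarrow> convergent_of_order N u T c w CARD('s)) \<and>
    (order_residual P Q R c (CARD('s) + 1) \<in> range (\<lambda>x. (mat 1 - P) *v x) \<and>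
      initial_order N u c w (CARD('s) + 1) \<longrightarrow>
        convergent_of_order N u T c w (CARD('s) + 1))"
proof (intro conjI impI)
  assume "initial_order N u c w CARD('s)"
  moreover have "K > 0"
    using \<open>peer_stable N F u T P Q R c w K\<close> by (simp add: peer_stable_def)
  ultimately show "convergent_of_order N u T c w CARD('s)"
    using assms by (intro convergent_of_stage_order)
next
  assume "order_residual P Q R c (CARD('s) + 1) \<in> range (\<lambda>x. (mat 1 - P) *v x) \<and>
    initial_order N u c w (CARD('s) + 1)"
  then obtain x where "order_residual P Q R c (CARD('s) + 1) = (mat 1 - P) *v x"
    and "initial_order N u c w (CARD('s) + 1)"
    by blast
  then show "convergent_of_order N u T c w (CARD('s) + 1)"
    using assms by (intro superconvergent_of_range_condition)
qed

end
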